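(* For every $p\in[1,\infty)$ there exist a bounded linear operator $A:L^p[0,1]\to L^p[0,1]$, data $b\in L^p[0,1]$ and a parameter $\gamma>0$ such that the continuous time inverse Potts functional $P_\gamma:L^p[0,1]\to[0,\infty]$ associated with $A$ and $b$, $$P_\gamma(u)=\begin{cases}\gamma\,\|\nabla u\|_0+\|Au-b\|_p^p,&\text{if }u\text{ is piecewise constant on }[0,1],\\ \infty,&\text{otherwise,}\end{cases}$$ does not have a minimizer, i.e., there is no $u^*\in L^p[0,1]$ with $P_\gamma(u^* )\le P_\gamma(u)$ for all $u\in L^p[0,1]$.
   Context: $L^p[0,1]$ is the Lebesgue space of (equivalence classes of) real-valued $p$-integrable functions on $[0,1]$ with norm $\|\cdot\|_p$. A function $u$ on $[0,1]$ is piecewise constant if (up to equality almost everywhere) there is a finite partition $0=t_0<t_1<\dots<t_N=1$ such that $u$ is constant on each interval $(t_{j-1},t_j)$; $\|\nabla u\|_0$ denotes its number of jumps, i.e., the number of points of the open interval $(0,1)$ at which the value of $u$ changes (the smallest possible value of $N-1$ over all such partitions). *)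

theory Defs
  imports "HOL-Analysis.Analysis"
begin

section \<open>Lebesgue spaces on the unit interval\<close>

abbreviation unit_leb :: "real measure" where
  "unit_leb \<equiv> lebesgue_on {0..1}"

text \<open>
  A single type of almost-everywhere equality classes of measurable functions on the unit
  interval serves all exponents: \<open>Lp p\<close> is the subset of the classes that are
  \<open>p\<close>-integrable. The values of a representative outside the unit interval are irrelevant.
\<close>

definition ae_rel :: "(real \<Rightarrow> real) \<Rightarrow> (real \<Rightarrow> real) \<Rightarrow> bool" where
  "ae_rel f g \<longleftrightarrow> f \<in> borel_measurable unit_leb \<and> g \<in> borel_measurable unit_leb \<and>
     (AE x in unit_leb. f x = g x)"

quotient_type fun_class = "real \<Rightarrow> real" / partial: ae_rel
proof (rule part_equivpI)
  show "\<exists>f. ae_rel f f"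
    by (rule exI[of _ "\<lambda>_. 0"]) (simp add: ae_rel_def)
  show "symp ae_rel"
    by (auto simp: symp_def ae_rel_def eq_commute)
  show "transp ae_rel"
    unfolding transp_def ae_rel_def by (auto elim: eventually_elim2)
qed

instantiation fun_class :: real_vector
begin

lift_definition zero_fun_class :: fun_class is "\<lambda>_. 0"
  by (simp add: ae_rel_def)

lift_definition plus_fun_class :: "fun_class \<Rightarrow> fun_class \<Rightarrow> fun_class" is "\<lambda>f g x. f x + g x"
  unfolding ae_rel_def by (auto elim: eventually_elim2)

lift_definition uminus_fun_class :: "fun_class \<Rightarrow> fun_class" is "\<lambda>f x. - f x"
  unfolding ae_rel_def by auto

lift_definition minus_fun_class :: "fun_class \<Rightarrow> fun_class \<Rightarrow> fun_class" is "\<lambda>f g x. f x - g x"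
  unfolding ae_rel_def by (auto elim: eventually_elim2)

lift_definition scaleR_fun_class :: "real \<Rightarrow> fun_class \<Rightarrow> fun_class" is "\<lambda>c f x. c * f x"
  unfolding ae_rel_def by auto

instance
  by standard (transfer; simp add: ae_rel_def algebra_simps)+

end

lift_definition p_integrable :: "real \<Rightarrow> fun_class \<Rightarrow> bool" is
  "\<lambda>p f. integrable unit_leb (\<lambda>x. \<bar>f x\<bar> powr p)"
  unfolding ae_rel_def by (intro integrable_cong_AE) auto

definition Lp :: "real \<Rightarrow> fun_class set" where
  "Lp p = {u. p_integrable p u}"

lift_definition Lp_norm :: "real \<Rightarrow> fun_class \<Rightarrow> real" is
  "\<lambda>p f. (integral\<^sup>L unit_leb (\<lambda>x. \<bar>f x\<bar> powr p)) powr (1 / p)"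
  unfolding ae_rel_def by (intro arg_cong2[where f = "(powr)"] integral_cong_AE) auto

lemma subspace_Lp:
  assumes "1 \<le> p"
  shows "subspace (Lp p)"
proof (rule subspaceI)
  show "0 \<in> Lp p"
    unfolding Lp_def mem_Collect_eq using assms by transfer simp
next
  fix u v assume "u \<in> Lp p" "v \<in> Lp p"
  then show "u + v \<in> Lp p"
    unfolding Lp_def mem_Collect_eq
  proof (transfer fixing: p)
    fix f g :: "real \<Rightarrow> real"
    assume "ae_rel f f" "ae_rel g g"
      and int: "integrable unit_leb (\<lambda>x. \<bar>f x\<bar> powr p)" "integrable unit_leb (\<lambda>x. \<bar>g x\<bar> powr p)"
    then have [measurable]: "f \<in> borel_measurable unit_leb" "g \<in> borel_measurable unit_leb"
      by (auto simp: ae_rel_def)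
    have bound: "\<bar>f x + g x\<bar> powr p \<le> 2 powr p * (\<bar>f x\<bar> powr p + \<bar>g x\<bar> powr p)" for x
    proof -
      have "\<bar>f x + g x\<bar> powr p \<le> (2 * max \<bar>f x\<bar> \<bar>g x\<bar>) powr p"
        using assms by (intro powr_mono2) auto
      also have "\<dots> = 2 powr p * max \<bar>f x\<bar> \<bar>g x\<bar> powr p"
        by (simp add: powr_mult)
      also have "\<dots> \<le> 2 powr p * (\<bar>f x\<bar> powr p + \<bar>g x\<bar> powr p)"
        by (intro mult_left_mono) (auto simp: max_def)
      finally show ?thesis .
    qed
    have "integrable unit_leb (\<lambda>x. 2 powr p * (\<bar>f x\<bar> powr p + \<bar>g x\<bar> powr p))"
      using int by simp
    then show "integrable unit_leb (\<lambda>x. \<bar>f x + g x\<bar> powr p)"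
      by (rule Bochner_Integration.integrable_bound) (use bound in auto)
  qed
next
  fix c u assume "u \<in> Lp p"
  then show "c *\<^sub>R u \<in> Lp p"
    unfolding Lp_def mem_Collect_eq by transfer (simp add: abs_mult powr_mult)
qed

text \<open>Values of \<open>A\<close> outside \<open>Lp p\<close> are unconstrained, so \<open>A\<close> represents a map on \<open>Lp p\<close>.\<close>

definition bounded_operator_on_Lp :: "real \<Rightarrow> (fun_class \<Rightarrow> fun_class) \<Rightarrow> bool" where
  "bounded_operator_on_Lp p A \<longleftrightarrow>
     (\<forall>u\<in>Lp p. A u \<in> Lp p) \<and>
     (\<forall>u\<in>Lp p. \<forall>v\<in>Lp p. A (u + v) = A u + A v) \<and>
     (\<forall>c. \<forall>u\<in>Lp p. A (c *\<^sub>R u) = c *\<^sub>R A u) \<and>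
     (\<exists>C. \<forall>u\<in>Lp p. Lp_norm p (A u) \<le> C * Lp_norm p u)"


section \<open>Piecewise constant functions and the inverse Potts functional\<close>

lift_definition constant_on_pieces :: "nat \<Rightarrow> fun_class \<Rightarrow> bool" is
  "\<lambda>N f. \<exists>t g. t 0 = 0 \<and> t N = 1 \<and> (\<forall>j<N. t j < t (Suc j)) \<and>
     (\<forall>j<N. g constant_on {t j<..<t (Suc j)}) \<and> (AE x in unit_leb. f x = g x)"
  unfolding ae_rel_def by (intro iff_exI conj_cong refl) (auto elim: eventually_elim2)

definition piecewise_constant :: "fun_class \<Rightarrow> bool" where
  "piecewise_constant u \<longleftrightarrow> (\<exists>N. constant_on_pieces N u)"

text \<open>
  The breakpoints of a partition into \<open>Suc k\<close> pieces that lie in the open unit interval are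
  \<open>k\<close> in number; a partition has at least one piece, as \<open>t 0 \<noteq> t N\<close>. Only meaningful for
  piecewise constant \<open>u\<close>.
\<close>

definition jumps :: "fun_class \<Rightarrow> nat" where
  "jumps u = (LEAST k. constant_on_pieces (Suc k) u)"

definition inverse_potts ::
    "real \<Rightarrow> real \<Rightarrow> (fun_class \<Rightarrow> fun_class) \<Rightarrow> fun_class \<Rightarrow> fun_class \<Rightarrow> ennreal" where
  "inverse_potts p \<gamma> A b u =
     (if piecewise_constant u
      then ennreal (\<gamma> * real (jumps u) + Lp_norm p (A u - b) powr p)
      else \<infinity>)"

end

theory Submission
  imports Defs
begin

text \<open>
  The counterexample is an operator of rank two. Two linear functionals \<open>u \<mapsto> (\<phi> u, \<psi> u)\<close>,
  combinations of the first three moments, are chosen such that a function with value \<open>a\<close> on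
  \<open>[0, s]\<close> and \<open>c\<close> on \<open>(s, 1]\<close> is sent to \<open>(a - c) (s (1 - s), s\<^sup>2 (1 - s))\<close>. The images of
  the functions with at most one jump then form a cone over the planar curve
  \<open>s \<mapsto> (s (1 - s), s\<^sup>2 (1 - s))\<close> that is not closed: the tangent direction \<open>(1, 0)\<close> of the
  curve at \<open>s = 0\<close> is a limit of points of the cone, since the height \<open>1 / (s (1 - s))\<close> gives
  the image \<open>(1, s)\<close>, but it does not belong to the cone, since a vanishing second coordinate
  forces \<open>a = c\<close> and thus the image \<open>(0, 0)\<close>.

  Let \<open>A u\<close> be the affine function \<open>x \<mapsto> \<phi> u + \<psi> u * x\<close> (\<open>rank_two_op\<close>), let the data \<open>b\<close> be the constant \<open>1\<close>
  and let \<open>\<gamma> = 1 / 2\<close>. One jump brings the data term as close to \<open>0\<close> as desired, so the infimum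
  of the functional is at most \<open>\<gamma>\<close> (\<open>potts_example_near_half\<close>). But every function has a
  value greater than \<open>\<gamma>\<close> (\<open>potts_example_gt_half\<close>): constants have \<open>A u = 0\<close> and
  hence the value \<open>1 > \<gamma>\<close>, one jump leaves a positive data term, and two jumps already cost
  \<open>2 \<gamma>\<close>. Moments are integrals against bounded weights, so \<open>A\<close> is bounded for every \<open>p \<ge> 1\<close>
  (\<open>integral_abs_le_norm\<close>).
\<close>

section \<open>Lebesgue measure on the unit interval\<close>

lemma emeasure_space_unit_leb: "emeasure unit_leb (space unit_leb) = 1"
  by (simp add: emeasure_restrict_space space_restrict_space)

lemma finite_measure_unit_leb: "finite_measure unit_leb"
  by (rule finite_measureI) (simp only: emeasure_space_unit_leb, simp)

lemma integrable_const_unit_leb: "integrable unit_leb (\<lambda>x. c :: real)"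
  by (rule finite_measure.integrable_const[OF finite_measure_unit_leb])

lemma integral_const_unit_leb: "integral\<^sup>L unit_leb (\<lambda>x. c :: real) = c"
  using emeasure_space_unit_leb by (simp add: measure_def)

lemma borel_measurable_id_unit_leb [measurable]: "(\<lambda>x. x) \<in> borel_measurable unit_leb"
  by (intro measurable_restrict_space1 measurable_completion) simp

lemma AE_unit_leb_notin_finite:
  assumes "finite F"
  shows "AE x in unit_leb. x \<notin> F"
proof -
  have "F \<in> null_sets lebesgue"
    using assms by (simp add: negligible_iff_null_sets[symmetric] negligible_finite)
  then have "AE x in lebesgue. x \<notin> F"
    by (rule AE_not_in)
  then show ?thesis
    by (subst AE_restrict_space_iff) (auto elim: eventually_mono)
qed

lemma AE_unit_leb_mem: "AE x in unit_leb. x \<in> {0..1}"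
  by (rule AE_I2) (simp add: space_restrict_space)

lemma AE_unit_leb_False: "\<not> (AE x in unit_leb. False)"
  using ae_filter_eq_bot_iff[of unit_leb] emeasure_space_unit_leb
  by (simp add: trivial_limit_def)


section \<open>Bounding the mean absolute value by the norm\<close>

lemma abs_le_one_plus_powr:
  fixes y p :: real
  assumes "1 \<le> p"
  shows "\<bar>y\<bar> \<le> 1 + \<bar>y\<bar> powr p"
proof (cases "\<bar>y\<bar> \<le> 1")
  case False
  then have "\<bar>y\<bar> powr 1 \<le> \<bar>y\<bar> powr p"
    using assms by (intro powr_mono) auto
  then show ?thesis
    using False by simp
qed (simp add: add_increasing2)

lemma integrable_if_powr_integrable:
  fixes f :: "real \<Rightarrow> real"
  assumes "1 \<le> p" "f \<in> borel_measurable unit_leb"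
    and "integrable unit_leb (\<lambda>x. \<bar>f x\<bar> powr p)"
  shows "integrable unit_leb f"
proof (rule Bochner_Integration.integrable_bound)
  show "integrable unit_leb (\<lambda>x. 1 + \<bar>f x\<bar> powr p)"
    using assms(3) integrable_const_unit_leb by (rule Bochner_Integration.integrable_add[rotated])
  show "AE x in unit_leb. norm (f x) \<le> norm (1 + \<bar>f x\<bar> powr p)"
    using abs_le_one_plus_powr[OF assms(1)] by (auto intro!: AE_I2 simp: abs_of_nonneg)
qed (use assms in auto)

text \<open>
  Applying \<open>\<bar>y\<bar> \<le> 1 + \<bar>y\<bar>\<^sup>p\<close> to \<open>f\<close> divided by its norm gives \<open>\<integral>\<bar>f\<bar> \<le> 2 \<parallel>f\<parallel>\<close>. The constant \<open>2\<close>
  is not sharp, but boundedness is all that matters, and convexity is avoided.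
\<close>

lemma integral_abs_le_norm:
  fixes f :: "real \<Rightarrow> real"
  assumes p: "1 \<le> p" and [measurable]: "f \<in> borel_measurable unit_leb"
    and int: "integrable unit_leb (\<lambda>x. \<bar>f x\<bar> powr p)"
  shows "integral\<^sup>L unit_leb (\<lambda>x. \<bar>f x\<bar>)
    \<le> 2 * (integral\<^sup>L unit_leb (\<lambda>x. \<bar>f x\<bar> powr p)) powr (1 / p)"
proof -
  define I where "I = integral\<^sup>L unit_leb (\<lambda>x. \<bar>f x\<bar> powr p)"
  define N where "N = I powr (1 / p)"
  have "0 \<le> I"
    unfolding I_def by simp
  have fint: "integrable unit_leb (\<lambda>x. \<bar>f x\<bar>)"
    using integrable_if_powr_integrable[OF p _ int] by simp
  show ?thesis
  proof (cases "I = 0")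
    case True
    then have "AE x in unit_leb. \<bar>f x\<bar> powr p = 0"
      using integral_nonneg_eq_0_iff_AE[OF int] by (simp add: I_def)
    then have "AE x in unit_leb. \<bar>f x\<bar> = 0"
      by eventually_elim simp
    then have "integral\<^sup>L unit_leb (\<lambda>x. \<bar>f x\<bar>) = 0"
      by (rule integral_eq_zero_AE)
    then show ?thesis
      by simp
  next
    case False
    with \<open>0 \<le> I\<close> have "N > 0"
      by (simp add: N_def)
    have Np: "N powr p = I"
      using \<open>0 \<le> I\<close> p by (simp add: N_def powr_powr)
    have bound: "\<bar>f x\<bar> \<le> N + N / I * \<bar>f x\<bar> powr p" for x
    proof -
      have "\<bar>f x / N\<bar> \<le> 1 + \<bar>f x / N\<bar> powr p"
        by (rule abs_le_one_plus_powr[OF p])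
      also have "\<bar>f x / N\<bar> powr p = \<bar>f x\<bar> powr p / I"
        using \<open>N > 0\<close> Np by (simp add: abs_divide powr_divide)
      finally show ?thesis
        using \<open>N > 0\<close> by (simp add: abs_divide field_simps)
    qed
    have "integral\<^sup>L unit_leb (\<lambda>x. \<bar>f x\<bar>)
        \<le> integral\<^sup>L unit_leb (\<lambda>x. N + N / I * \<bar>f x\<bar> powr p)"
      using fint int integrable_const_unit_leb
      by (intro integral_mono bound Bochner_Integration.integrable_add integrable_mult_right) auto
    also have "\<dots> = N + N / I * I"
      using int integrable_const_unit_leb
      by (subst Bochner_Integration.integral_add)
        (simp_all add: integral_const_unit_leb I_def del: lebesgue_integral_const)
    finally show ?thesis
      using False by (simp add: N_def I_def)
  qed
qed


section \<open>Moments\<close>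

lift_definition moment :: "nat \<Rightarrow> fun_class \<Rightarrow> real" is
  "\<lambda>k f. integral\<^sup>L unit_leb (\<lambda>x. x ^ k * f x)"
  unfolding ae_rel_def
  by (intro integral_cong_AE borel_measurable_times borel_measurable_power
      borel_measurable_id_unit_leb) (auto elim: eventually_mono)

lemma moment_integrand_bound:
  fixes f :: "real \<Rightarrow> real"
  shows "AE x in unit_leb. \<bar>x ^ k * f x\<bar> \<le> \<bar>f x\<bar>"
  using AE_unit_leb_mem
proof eventually_elim
  case (elim x)
  then have "\<bar>x ^ k\<bar> \<le> 1"
    by (simp add: power_abs power_le_one)
  then show ?case
    by (simp add: abs_mult mult_left_le_one_le)
qed

lemma integrable_moment_integrand:
  fixes f :: "real \<Rightarrow> real"
  assumes "1 \<le> p" "f \<in> borel_measurable unit_leb"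
    and "integrable unit_leb (\<lambda>x. \<bar>f x\<bar> powr p)"
  shows "integrable unit_leb (\<lambda>x. x ^ k * f x)"
  using integrable_if_powr_integrable[OF assms]
  by (rule Bochner_Integration.integrable_bound)
    (use moment_integrand_bound[of k f] assms(2) in
      \<open>auto intro!: borel_measurable_times borel_measurable_power borel_measurable_id_unit_leb\<close>)

lemma moment_add:
  assumes "1 \<le> p" "u \<in> Lp p" "v \<in> Lp p"
  shows "moment k (u + v) = moment k u + moment k v"
  using assms(2,3) unfolding Lp_def mem_Collect_eq
proof (transfer fixing: p k)
  fix f g :: "real \<Rightarrow> real"
  assume "ae_rel f f" "ae_rel g g"
    and "integrable unit_leb (\<lambda>x. \<bar>f x\<bar> powr p)" "integrable unit_leb (\<lambda>x. \<bar>g x\<bar> powr p)"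
  then have "integrable unit_leb (\<lambda>x. x ^ k * f x)" "integrable unit_leb (\<lambda>x. x ^ k * g x)"
    using integrable_moment_integrand[OF assms(1)] by (auto simp: ae_rel_def)
  then show "integral\<^sup>L unit_leb (\<lambda>x. x ^ k * (f x + g x))
      = integral\<^sup>L unit_leb (\<lambda>x. x ^ k * f x) + integral\<^sup>L unit_leb (\<lambda>x. x ^ k * g x)"
    by (simp add: distrib_left)
qed

lemma moment_scaleR: "moment k (c *\<^sub>R u) = c * moment k u"
  by transfer (simp add: mult.left_commute)

lemma moment_bound:
  assumes "1 \<le> p" "u \<in> Lp p"
  shows "\<bar>moment k u\<bar> \<le> 2 * Lp_norm p u"
  using assms(2) unfolding Lp_def mem_Collect_eq
proof (transfer fixing: p k)
  fix f :: "real \<Rightarrow> real"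
  assume "ae_rel f f" and int: "integrable unit_leb (\<lambda>x. \<bar>f x\<bar> powr p)"
  then have f: "f \<in> borel_measurable unit_leb"
    by (simp add: ae_rel_def)
  have "\<bar>integral\<^sup>L unit_leb (\<lambda>x. x ^ k * f x)\<bar> \<le> integral\<^sup>L unit_leb (\<lambda>x. \<bar>x ^ k * f x\<bar>)"
    by (rule integral_abs_bound)
  also have "\<dots> \<le> integral\<^sup>L unit_leb (\<lambda>x. \<bar>f x\<bar>)"
    using integrable_moment_integrand[OF assms(1) f int]
      integrable_if_powr_integrable[OF assms(1) f int] moment_integrand_bound
    by (intro integral_mono_AE) auto
  also have "\<dots> \<le> 2 * (integral\<^sup>L unit_leb (\<lambda>x. \<bar>f x\<bar> powr p)) powr (1 / p)"
    by (rule integral_abs_le_norm[OF assms(1) f int])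
  finally show "\<bar>integral\<^sup>L unit_leb (\<lambda>x. x ^ k * f x)\<bar>
      \<le> 2 * (integral\<^sup>L unit_leb (\<lambda>x. \<bar>f x\<bar> powr p)) powr (1 / p)" .
qed


section \<open>Affine functions in the Lebesgue spaces\<close>

lift_definition affine_class :: "real \<Rightarrow> real \<Rightarrow> fun_class" is "\<lambda>a c x. a + c * x"
  by (simp add: ae_rel_def)

lemma affine_class_add: "affine_class (a + a') (c + c') = affine_class a c + affine_class a' c'"
  by transfer (simp add: ae_rel_def algebra_simps)

lemma affine_class_diff: "affine_class (a - a') (c - c') = affine_class a c - affine_class a' c'"
  by transfer (simp add: ae_rel_def algebra_simps)

lemma affine_class_scaleR: "affine_class (r * a) (r * c) = r *\<^sub>R affine_class a c"
  by transfer (simp add: ae_rel_def algebra_simps)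

lemma affine_powr_bound:
  fixes a c p :: real
  assumes "1 \<le> p"
  shows "AE x in unit_leb. \<bar>a + c * x\<bar> powr p \<le> (\<bar>a\<bar> + \<bar>c\<bar>) powr p"
  using AE_unit_leb_mem
proof eventually_elim
  case (elim x)
  then have "\<bar>c * x\<bar> \<le> \<bar>c\<bar>"
    by (simp add: abs_mult mult_left_le)
  then have "\<bar>a + c * x\<bar> \<le> \<bar>a\<bar> + \<bar>c\<bar>"
    by linarith
  then show ?case
    using assms by (intro powr_mono2) auto
qed

lemma integrable_affine_powr:
  fixes a c p :: real
  assumes "1 \<le> p"
  shows "integrable unit_leb (\<lambda>x. \<bar>a + c * x\<bar> powr p)"
  by (rule Bochner_Integration.integrable_bound
      [OF integrable_const_unit_leb[of "(\<bar>a\<bar> + \<bar>c\<bar>) powr p"]])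
    (use affine_powr_bound[OF assms, of a c] in auto)

lemma affine_class_in_Lp:
  assumes "1 \<le> p"
  shows "affine_class a c \<in> Lp p"
  unfolding Lp_def mem_Collect_eq
  by (transfer fixing: p a c) (rule integrable_affine_powr[OF assms])

lemma Lp_norm_affine_class_powr:
  assumes "1 \<le> p"
  shows "Lp_norm p (affine_class a c) powr p = integral\<^sup>L unit_leb (\<lambda>x. \<bar>a + c * x\<bar> powr p)"
  using assms by (transfer fixing: p a c) (simp add: powr_powr)

lemma Lp_norm_affine_class_powr_le:
  assumes "1 \<le> p"
  shows "Lp_norm p (affine_class a c) powr p \<le> (\<bar>a\<bar> + \<bar>c\<bar>) powr p"
proof -
  have "integral\<^sup>L unit_leb (\<lambda>x. \<bar>a + c * x\<bar> powr p)
      \<le> integral\<^sup>L unit_leb (\<lambda>x. (\<bar>a\<bar> + \<bar>c\<bar>) powr p)"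
    using affine_powr_bound[OF assms] integrable_affine_powr[OF assms] integrable_const_unit_leb
    by (intro integral_mono_AE)
  then show ?thesis
    by (simp only: Lp_norm_affine_class_powr[OF assms] integral_const_unit_leb)
qed

lemma Lp_norm_affine_class_le:
  assumes "1 \<le> p"
  shows "Lp_norm p (affine_class a c) \<le> \<bar>a\<bar> + \<bar>c\<bar>"
proof (rule ccontr)
  assume "\<not> ?thesis"
  then have "(\<bar>a\<bar> + \<bar>c\<bar>) powr p < Lp_norm p (affine_class a c) powr p"
    using assms by (intro powr_less_mono2) auto
  then show False
    using Lp_norm_affine_class_powr_le[OF assms, of a c] by simp
qed

lemma Lp_norm_const_powr:
  assumes "1 \<le> p"
  shows "Lp_norm p (affine_class a 0) powr p = \<bar>a\<bar> powr p"
  by (simp only: Lp_norm_affine_class_powr[OF assms] mult_zero_left add_0_right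
      integral_const_unit_leb)

lemma Lp_norm_affine_class_eq_0D:
  assumes "1 \<le> p" "Lp_norm p (affine_class a c) powr p = 0"
  shows "a = 0 \<and> c = 0"
proof (rule ccontr)
  assume nz: "\<not> ?thesis"
  have "AE x in unit_leb. \<bar>a + c * x\<bar> powr p = 0"
    using assms(2) integral_nonneg_eq_0_iff_AE[OF integrable_affine_powr[OF assms(1), of a c]]
    by (simp add: Lp_norm_affine_class_powr[OF assms(1)])
  \<comment> \<open>a nonzero affine function has at most one zero, and points are null sets\<close>
  moreover have "AE x in unit_leb. x \<notin> {- a / c}"
    by (rule AE_unit_leb_notin_finite) simp
  ultimately have "AE x in unit_leb. False"
  proof eventually_elim
    case (elim x)
    then have "a + c * x = 0" "x \<noteq> - a / c"
      by auto
    then show ?case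
      using nz by (cases "c = 0") (auto simp: field_simps)
  qed
  then show False
    using AE_unit_leb_False by simp
qed


section \<open>Functions with at most one jump\<close>

lift_definition two_valued :: "real \<Rightarrow> real \<Rightarrow> real \<Rightarrow> fun_class" is
  "\<lambda>s a c x. if x \<le> s then a else c"
  by (simp add: ae_rel_def)

lemma two_valued_in_Lp: "two_valued s a c \<in> Lp p"
  unfolding Lp_def mem_Collect_eq
proof (transfer fixing: s a c p)
  show "integrable unit_leb (\<lambda>x. \<bar>if x \<le> s then a else c\<bar> powr p)"
    by (rule Bochner_Integration.integrable_bound
        [OF integrable_const_unit_leb[of "\<bar>a\<bar> powr p + \<bar>c\<bar> powr p"]]) auto
qed

lemma moment_two_valued:
  assumes "0 \<le> s" "s \<le> 1"
  shows "moment k (two_valued s a c) = (a * s ^ Suc k + c * (1 - s ^ Suc k)) / Suc k"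
proof (transfer fixing: s a c k)
  let ?f = "\<lambda>x. x ^ k * (if x \<le> s then a else c)"
  have prim: "((\<lambda>x. x ^ k * d) has_integral d * (v ^ Suc k - w ^ Suc k) / Suc k) {w..v}"
    if "w \<le> v" for d v w :: real
  proof -
    have "((\<lambda>x. x ^ k * d) has_integral d * v ^ Suc k / Suc k - d * w ^ Suc k / Suc k) {w..v}"
      using that
      by (intro fundamental_theorem_of_calculus)
        (auto intro!: derivative_eq_intros simp flip: has_real_derivative_iff_has_vector_derivative
          simp del: power_Suc)
    then show ?thesis
      by (simp add: right_diff_distrib diff_divide_distrib)
  qed
  have left: "(?f has_integral a * (s ^ Suc k - 0 ^ Suc k) / Suc k) {0..s}"
    by (rule has_integral_eq[OF _ prim[OF assms(1)]]) simp
  have right: "(?f has_integral c * (1 ^ Suc k - s ^ Suc k) / Suc k) {s..1}"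
    by (rule has_integral_spike_finite[OF _ _ prim[OF assms(2)], where S = "{s}"]) auto
  have "(?f has_integral (a * s ^ Suc k + c * (1 - s ^ Suc k)) / Suc k) {0..1}"
    using has_integral_combine[OF assms left right] by (simp add: add_divide_distrib)
  moreover have "integrable unit_leb ?f"
  proof (rule integrable_moment_integrand[of 1])
    show "integrable unit_leb (\<lambda>x. \<bar>if x \<le> s then a else c\<bar> powr 1)"
      by (rule Bochner_Integration.integrable_bound
          [OF integrable_const_unit_leb[of "\<bar>a\<bar> + \<bar>c\<bar>"]]) auto
  qed auto
  ultimately show "integral\<^sup>L unit_leb ?f = (a * s ^ Suc k + c * (1 - s ^ Suc k)) / Suc k"
    by (simp add: lebesgue_integral_eq_integral integral_unique)
qed

lemma constant_on_pieces_two_valued: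
  assumes "0 < s" "s < 1"
  shows "constant_on_pieces (Suc 1) (two_valued s a c)"
proof (transfer fixing: s a c)
  let ?g = "\<lambda>x. if x \<le> s then a else c"
  let ?t = "\<lambda>j :: nat. if j = 0 then 0 else if j = 1 then s else 1"
  show "\<exists>t g. t 0 = 0 \<and> t (Suc 1) = 1 \<and> (\<forall>j<Suc 1. t j < t (Suc j)) \<and>
      (\<forall>j<Suc 1. g constant_on {t j<..<t (Suc j)}) \<and> (AE x in unit_leb. ?g x = g x)"
    by (rule exI[of _ ?t], rule exI[of _ ?g])
      (use assms in \<open>auto simp: less_Suc_eq constant_on_def\<close>)
qed

text \<open>
  A constant counts as a two-valued function with equal values, so that one formula for the
  moments serves constants and functions with one jump.
\<close>

lemma constant_if_one_piece:
  assumes "constant_on_pieces (Suc 0) u"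
  shows "\<exists>c. \<forall>s. u = two_valued s c c"
  using assms
proof transfer
  fix f :: "real \<Rightarrow> real"
  assume f: "ae_rel f f" and "\<exists>t g. t 0 = 0 \<and> t (Suc 0) = 1 \<and> (\<forall>j<Suc 0. t j < t (Suc j)) \<and>
      (\<forall>j<Suc 0. g constant_on {t j<..<t (Suc j)}) \<and> (AE x in unit_leb. f x = g x)"
  then obtain g where g: "g constant_on {0<..<1::real}" and fg: "AE x in unit_leb. f x = g x"
    by force
  from g obtain c where c: "\<And>x. 0 < x \<Longrightarrow> x < 1 \<Longrightarrow> g x = c"
    by (auto simp: constant_on_def)
  have notin: "AE x in unit_leb. x \<notin> {0, 1}"
    by (rule AE_unit_leb_notin_finite) simp
  have "AE x in unit_leb. f x = c"
    using fg AE_unit_leb_mem notin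
    by eventually_elim (use c in auto)
  then show "\<exists>c. \<forall>s. ae_rel f (\<lambda>x. if x \<le> s then c else c)"
    using f by (auto simp: ae_rel_def)
qed

lemma two_valued_if_two_pieces:
  assumes "constant_on_pieces (Suc 1) u"
  shows "\<exists>s a c. 0 < s \<and> s < 1 \<and> u = two_valued s a c"
  using assms
proof transfer
  fix f :: "real \<Rightarrow> real"
  assume f: "ae_rel f f" and "\<exists>t g. t 0 = 0 \<and> t (Suc 1) = 1 \<and> (\<forall>j<Suc 1. t j < t (Suc j)) \<and>
      (\<forall>j<Suc 1. g constant_on {t j<..<t (Suc j)}) \<and> (AE x in unit_leb. f x = g x)"
  then obtain t g where t: "t 0 = 0" "t (Suc 1) = 1" "\<And>j. j < Suc 1 \<Longrightarrow> t j < t (Suc j)"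
    and g: "\<And>j. j < Suc 1 \<Longrightarrow> g constant_on {t j<..<t (Suc j)}"
    and fg: "AE x in unit_leb. f x = g x"
    by blast
  define s where "s = t 1"
  have s: "0 < s" "s < 1"
    using t(3)[of 0] t(3)[of 1] t(1,2) by (auto simp: s_def)
  have "g constant_on {0<..<s}" "g constant_on {s<..<1}"
    using g[of 0] g[of 1] t(1,2) by (auto simp: s_def)
  then obtain a c where a: "\<And>x. 0 < x \<Longrightarrow> x < s \<Longrightarrow> g x = a"
    and c: "\<And>x. s < x \<Longrightarrow> x < 1 \<Longrightarrow> g x = c"
    by (auto simp: constant_on_def)
  have notin: "AE x in unit_leb. x \<notin> {0, s, 1}"
    by (rule AE_unit_leb_notin_finite) simp
  have "AE x in unit_leb. f x = (if x \<le> s then a else c)"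
    using fg AE_unit_leb_mem notin
    by eventually_elim (use a c in auto)
  then have "ae_rel f (\<lambda>x. if x \<le> s then a else c)"
    using f by (simp add: ae_rel_def)
  then show "\<exists>s a c. 0 < s \<and> s < 1 \<and> ae_rel f (\<lambda>x. if x \<le> s then a else c)"
    using s by blast
qed

lemma piecewise_constant_jumps:
  assumes "piecewise_constant u"
  shows "constant_on_pieces (Suc (jumps u)) u"
proof -
  obtain N where N: "constant_on_pieces N u"
    using assms by (auto simp: piecewise_constant_def)
  have "\<not> constant_on_pieces 0 u"
    by transfer auto
  with N obtain k where "constant_on_pieces (Suc k) u"
    by (cases N) auto
  then show ?thesis
    unfolding jumps_def by (rule LeastI)
qed


section \<open>The rank-two operator\<close>

text \<open>
  The weights \<open>1 - 2 x\<close> and \<open>2 x - 3 x\<^sup>2\<close> are the derivatives of \<open>s (1 - s)\<close> and \<open>s\<^sup>2 (1 - s)\<close>,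
  the coordinates of the curve of images. Both integrate to \<open>0\<close>, which makes the operator
  vanish on constants.
\<close>

definition rank_two_op :: "fun_class \<Rightarrow> fun_class" where
  "rank_two_op u = affine_class (moment 0 u - 2 * moment 1 u) (2 * moment 1 u - 3 * moment 2 u)"

lemma bounded_rank_two_op:
  assumes p: "1 \<le> p"
  shows "bounded_operator_on_Lp p rank_two_op"
  unfolding bounded_operator_on_Lp_def
proof (intro conjI ballI allI exI)
  fix u v c assume u: "u \<in> Lp p"
  show "rank_two_op u \<in> Lp p"
    unfolding rank_two_op_def by (rule affine_class_in_Lp[OF p])
  show "rank_two_op (c *\<^sub>R u) = c *\<^sub>R rank_two_op u"
    unfolding rank_two_op_def
    by (simp add: moment_scaleR affine_class_scaleR[symmetric] algebra_simps)
  show "rank_two_op (u + v) = rank_two_op u + rank_two_op v" if "v \<in> Lp p"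
    unfolding rank_two_op_def
    by (simp add: moment_add[OF p u that] affine_class_add[symmetric] algebra_simps)
  have "Lp_norm p (rank_two_op u)
      \<le> \<bar>moment 0 u - 2 * moment 1 u\<bar> + \<bar>2 * moment 1 u - 3 * moment 2 u\<bar>"
    unfolding rank_two_op_def by (rule Lp_norm_affine_class_le[OF p])
  also have "\<dots> \<le> 16 * Lp_norm p u"
    using moment_bound[OF p u, of 0] moment_bound[OF p u, of 1] moment_bound[OF p u, of 2]
    by linarith
  finally show "Lp_norm p (rank_two_op u) \<le> 16 * Lp_norm p u" .
qed

lemma rank_two_op_two_valued:
  assumes "0 \<le> s" "s \<le> 1"
  shows "rank_two_op (two_valued s a c)
    = affine_class ((a - c) * (s * (1 - s))) ((a - c) * (s\<^sup>2 * (1 - s)))"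
proof -
  have "moment 0 (two_valued s a c) = a * s + c * (1 - s)"
    "2 * moment 1 (two_valued s a c) = a * s\<^sup>2 + c * (1 - s\<^sup>2)"
    "3 * moment 2 (two_valued s a c) = a * s ^ 3 + c * (1 - s ^ 3)"
    by (simp_all add: moment_two_valued[OF assms] numeral_eq_Suc)
  then have "moment 0 (two_valued s a c) - 2 * moment 1 (two_valued s a c)
      = (a - c) * (s * (1 - s))"
    "2 * moment 1 (two_valued s a c) - 3 * moment 2 (two_valued s a c)
      = (a - c) * (s\<^sup>2 * (1 - s))"
    by (simp_all only:) (simp_all add: algebra_simps power2_eq_square power3_eq_cube)
  then show ?thesis
    by (simp only: rank_two_op_def)
qed

abbreviation potts_example :: "real \<Rightarrow> fun_class \<Rightarrow> ennreal" where
  "potts_example p \<equiv> inverse_potts p (1 / 2) rank_two_op (affine_class 1 0)"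

text \<open>
  The height \<open>1 / (s (1 - s))\<close> normalises the first coordinate of the image to \<open>1\<close>, so that the
  residual is \<open>x \<mapsto> s x\<close>. It tends to \<open>0\<close> with \<open>s\<close> although the heights blow up.
\<close>

lemma potts_example_near_half:
  assumes p: "1 \<le> p" and s: "0 < s" "s < 1"
  shows "potts_example p (two_valued s (1 / (s * (1 - s))) 0) \<le> ennreal (1 / 2 + s)"
proof -
  let ?v = "two_valued s (1 / (s * (1 - s))) 0"
  have pieces: "constant_on_pieces (Suc 1) ?v"
    by (rule constant_on_pieces_two_valued[OF s])
  then have "jumps ?v \<le> 1"
    unfolding jumps_def by (rule Least_le)
  have "1 / (s * (1 - s)) * (s\<^sup>2 * (1 - s)) = s" "1 / (s * (1 - s)) * (s * (1 - s)) = 1"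
    using s by (simp_all add: field_simps power2_eq_square)
  then have "rank_two_op ?v = affine_class 1 s"
    using s by (simp only: rank_two_op_two_valued less_imp_le diff_0_right)
  then have "rank_two_op ?v - affine_class 1 0 = affine_class 0 s"
    by (simp add: affine_class_diff[symmetric])
  moreover have "Lp_norm p (affine_class 0 s) powr p \<le> s powr p"
    using Lp_norm_affine_class_powr_le[OF p, of 0 s] s by simp
  moreover have "s powr p \<le> s powr 1"
    using p s by (intro powr_mono') auto
  ultimately have "Lp_norm p (rank_two_op ?v - affine_class 1 0) powr p \<le> s"
    using s by simp
  then have "1 / 2 * real (jumps ?v) + Lp_norm p (rank_two_op ?v - affine_class 1 0) powr p
      \<le> 1 / 2 + s"
    using \<open>jumps ?v \<le> 1\<close> by simp
  moreover have "piecewise_constant ?v"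
    using pieces unfolding piecewise_constant_def by blast
  ultimately show ?thesis
    unfolding inverse_potts_def by (simp only: if_True) (rule ennreal_leI)
qed

lemma potts_example_gt_half:
  assumes p: "1 \<le> p"
  shows "ennreal (1 / 2) < potts_example p u"
proof (cases "piecewise_constant u")
  case False
  then show ?thesis
    by (simp only: inverse_potts_def if_False infinity_ennreal_def ennreal_less_top)
next
  case True
  define R where "R = Lp_norm p (rank_two_op u - affine_class 1 0) powr p"
  have "R \<ge> 0"
    by (simp add: R_def)
  have pieces: "constant_on_pieces (Suc (jumps u)) u"
    by (rule piecewise_constant_jumps[OF True])
  have "1 / 2 < 1 / 2 * real (jumps u) + R"
  proof -
    consider "jumps u = 0" | "jumps u = 1" | "jumps u \<ge> 2"
      by linarith
    then show ?thesis
    proof cases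
      case 1
      with pieces obtain c where "\<And>s. u = two_valued s c c"
        using constant_if_one_piece by metis
      then have "u = two_valued 0 c c" .
      then have "rank_two_op u - affine_class 1 0 = affine_class (-1) 0"
        by (simp add: rank_two_op_two_valued affine_class_diff[symmetric])
      then have "R = 1"
        by (simp add: R_def Lp_norm_const_powr[OF p])
      then show ?thesis
        using 1 by simp
    next
      case 2
      with pieces obtain s a c where s: "0 < s" "s < 1" and u: "u = two_valued s a c"
        using two_valued_if_two_pieces by metis
      let ?d = "a - c"
      have "rank_two_op u - affine_class 1 0
          = affine_class (?d * (s * (1 - s)) - 1) (?d * (s\<^sup>2 * (1 - s)))"
        using s by (simp add: u rank_two_op_two_valued affine_class_diff[symmetric])
      then have R: "R = Lp_norm p (affine_class (?d * (s * (1 - s)) - 1) (?d * (s\<^sup>2 * (1 - s)))) powr p"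
        by (simp only: R_def)
      have "R \<noteq> 0"
      proof
        assume "R = 0"
        then have "?d * (s * (1 - s)) - 1 = 0 \<and> ?d * (s\<^sup>2 * (1 - s)) = 0"
          unfolding R by (rule Lp_norm_affine_class_eq_0D[OF p])
        moreover from this have "?d = 0"
          using s by simp
        ultimately show False
          by simp
      qed
      then show ?thesis
        using 2 \<open>R \<ge> 0\<close> by simp
    next
      case 3
      then show ?thesis
        using \<open>R \<ge> 0\<close> by linarith
    qed
  qed
  then show ?thesis
    using ennreal_less_iff[of "1 / 2"]
    by (simp only: inverse_potts_def if_P[OF True] R_def[symmetric])
qed

theorem theorem2:
  fixes p :: real
  assumes "1 \<le> p"
  shows "\<exists>A b \<gamma>. bounded_operator_on_Lp p A \<and> b \<in> Lp p \<and> \<gamma> > 0 \<and>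
    \<not> (\<exists>u\<in>Lp p. \<forall>v\<in>Lp p. inverse_potts p \<gamma> A b u \<le> inverse_potts p \<gamma> A b v)"
proof -
  have "\<not> (\<exists>u\<in>Lp p. \<forall>v\<in>Lp p. potts_example p u \<le> potts_example p v)"
  proof
    assume "\<exists>u\<in>Lp p. \<forall>v\<in>Lp p. potts_example p u \<le> potts_example p v"
    then obtain u where min: "\<And>v. v \<in> Lp p \<Longrightarrow> potts_example p u \<le> potts_example p v"
      by blast
    have le: "potts_example p u \<le> ennreal (1 / 2 + s)" if "0 < s" "s < 1" for s
      using min[OF two_valued_in_Lp] potts_example_near_half[OF assms that] by (rule order_trans)
    have "potts_example p u \<noteq> \<infinity>"
      using le[of "1 / 2"] by (auto simp: top_unique)
    then obtain r where r: "potts_example p u = ennreal r" "0 \<le> r"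
      by (cases "potts_example p u") auto
    have "1 / 2 < r"
      using potts_example_gt_half[OF assms, of u] ennreal_less_iff[of "1 / 2" r]
      by (simp only: r(1))
    \<comment> \<open>half of the excess over \<open>1 / 2\<close>, cut off to remain below \<open>1\<close>\<close>
    define s where "s = min ((r - 1 / 2) / 2) (1 / 2)"
    have "0 < s" "s < 1" "1 / 2 + s < r" "0 \<le> 1 / 2 + s"
      using \<open>1 / 2 < r\<close> by (auto simp: s_def min_def field_simps)
    moreover have "r \<le> 1 / 2 + s"
      using le[OF \<open>0 < s\<close> \<open>s < 1\<close>] \<open>0 \<le> 1 / 2 + s\<close> by (simp only: r(1) ennreal_le_iff)
    ultimately show False
      by linarith
  qed
  moreover have "affine_class 1 0 \<in> Lp p"
    by (rule affine_class_in_Lp[OF assms])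
  ultimately show ?thesis
    using bounded_rank_two_op[OF assms]
    by (intro exI[of _ rank_two_op] exI[of _ "affine_class 1 0"] exI[of _ "1 / 2"]) auto
qed

end
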